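(* Let (PP) be a polynomial problem and let $(\mathrm{LP}_1)$, $(\mathrm{LP}_2)$, $(\mathrm{LP}_3)$ be the RLT relaxations (with $J$-sets) of the quadratic problems obtained from (PP) by applying quadrification Schemes 1, 2 and 3, respectively. Let $N^{LP}_1$, $N^{LP}_2$, $N^{LP}_3$ be the numbers of variables, and $R^{LP}_1$, $R^{LP}_2$, $R^{LP}_3$ the numbers of constraints, in $(\mathrm{LP}_1)$, $(\mathrm{LP}_2)$, $(\mathrm{LP}_3)$, respectively. Then $N^{LP}_1\leq N^{LP}_2\leq N^{LP}_3$ and $R^{LP}_1\leq R^{LP}_2\leq R^{LP}_3$.
   Context: **Polynomial problem.** (PP) is: minimize $\phi_0(x)$ subject to $\phi_r(x)\ge\beta_r$ for $r=1,\dots,R_1$, $\phi_r(x)=\beta_r$ for $r=R_1+1,\dots,R$, and $x\in\Omega=\{x\in\mathbb{R}^n: 0\le l_j\le x_j\le u_j<\infty,\ j\in N\}$, where $N=\{1,\dots,n\}$ and each $\phi_r$ is a polynomial of degree $\delta_r$; $\delta=\max_{0\le r\le R}\delta_r$ is the degree of (PP). Each monomial $\prod_{j\in J}x_j$ is identified with the multiset $J$ of its variable indices (with repetition); $|J|$ is its size counted with repetition. Unions and inclusions of multisets are taken with multiplicity ($J_1\cup J_2$ is the multiset sum). A monomial appears in (PP) if it occurs in some $\phi_r$, $0\le r\le R$. **$J$-sets.** The $J$-sets of a polynomial problem are the multisets of the monomials of degree greater than one appearing in it that are not strictly contained in the multiset of another monomial appearing in it. $\mathbb{J}$ is the set of $J$-sets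 of (PP). **RLT relaxation with $J$-sets.** Given a polynomial problem in variables $y_i$ with bounds $l_i\le y_i\le u_i$, its RLT relaxation with $J$-sets is obtained as follows. For each $J$-set $J$ and all multisets $J_1,J_2$ with $J_1\cup J_2=J$, add the bound-factor constraint $\prod_{i\in J_1}(y_i-l_i)\prod_{i\in J_2}(u_i-y_i)\ge 0$. Then linearize everything (operator $[\cdot]_L$): replace each monomial of degree greater than one, with multiset $I$, by a new RLT variable $X^{RLT}_I$. **Quadrification variables.** $X^Q_J$ denotes a new variable representing $\prod_{j\in J}x_j$, with $X^Q_{\{j\}}=x_j$; its bounds are the products of the corresponding bounds of the $x_j$. In all schemes, every monomial of degree greater than 2 in $\phi_0,\dots,\phi_R$ is replaced by $X^Q_J$, and quadratic constraints are added: - Scheme 1: for each monomial $J=\{j_1,\dots,j_{|J|}\}$ (indices listed in nondecreasing order) appearing in (PP) with $|J|>2$, add $X^Q_{j_1\dots j_k}=X^Q_{j_1\dots j_{k-1}}x_{j_k}$ for $k=|J|,|J|-1,\dots,3$ and $X^Q_{j_1j_2}=x_{j_1}x_{j_2}$. - Scheme 2: for each $J\in\mathbb{J}$ with $|J|>2$ and each $J'\subseteq J$ with $|J'|\ge2$, add $X^Q_{J'}=X^Q_{J_1}X^Q_{J_2}$ for each unordered pair of nonempty multisets $J_1,J_2$ with $J_1\cup J_2=J'$. - Scheme 3: for each multiset $J'$ with elements in $N$ and $2\le|J'|\le\delta$, add $X^Q_{J'}=X^Q_{J_1}X^Q_{J_2}$ for each unordered pair of nonempty multisets $J_1,J_2$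 with $J_1\cup J_2=J'$. The result is a quadratic problem in the variables $x_j$ and $X^Q_J$. $(\mathrm{LP}_i)$ is the RLT relaxation with $J$-sets of the quadratic problem from Scheme $i$. Its $J$-sets are all size-two multisets of variables (of the quadratic problem) whose product occurs in that problem. **Counting.** The number of variables counts the $x_j$, the $X^Q$ variables and the RLT variables. An $X^Q$ variable and an RLT variable are regarded as distinct even if they represent the same product of the $x_j$. An RLT variable is counted for every submultiset of size at least two of a $J$-set (bounds being treated symbolically when expanding bound factors). The number of constraints counts the $R$ (linearized) constraints of (PP), the linearized quadratic constraints of the scheme and the linearized bound-factor constraints; the box constraints $x\in\Omega$ are not counted. Identical constraints or variables arising several times are counted once. *)

theory Defs
  imports Complex_Main "HOL-Library.Multiset" "HOL-Library.Poly_Mapping"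
begin

text \<open>A monomial is the multiset of its variables, so a multivariate polynomial is a finitely
  supported map from multisets to coefficients; its ring multiplication adds multisets. The
  coefficient ring is a parameter because constraints are counted with symbolic bounds (below).\<close>

type_synonym ('v, 'c) mpoly = "'v multiset \<Rightarrow>\<^sub>0 'c"

definition var :: "'v \<Rightarrow> ('v, 'c::comm_ring_1) mpoly" where
  "var v = Poly_Mapping.single {#v#} 1"

definition const :: "'c \<Rightarrow> ('v, 'c::comm_ring_1) mpoly" where
  "const c = Poly_Mapping.single {#} c"

definition total_degree :: "('v, 'c::comm_ring_1) mpoly \<Rightarrow> nat" where
  "total_degree p = Max (insert 0 (size ` Poly_Mapping.keys p))"

definition map_monomials ::
    "('v multiset \<Rightarrow> 'w multiset) \<Rightarrow> ('v, 'c::comm_ring_1) mpoly \<Rightarrow> ('w, 'c) mpoly" where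
  "map_monomials f p = (\<Sum>m\<in>Poly_Mapping.keys p. Poly_Mapping.single (f m) (Poly_Mapping.lookup p m))"

text \<open>\<open>Ge p b\<close> stands for \<open>p \<ge> b\<close> and \<open>Eq p b\<close> for \<open>p = b\<close>; the type of the left-hand side is
  a parameter so that \<open>map_constr_of\<close> can transform the polynomial and the constant.\<close>

datatype ('p, 'c) constr_of = Ge (body: 'p) (rhs: 'c) | Eq (body: 'p) (rhs: 'c)

type_synonym ('v, 'c) constr = "(('v, 'c) mpoly, 'c) constr_of"

record (overloaded) ('v, 'c) problem =
  vars :: "'v set"
  objective :: "('v, 'c) mpoly"
  constraints :: "('v, 'c) constr set"
  lower :: "'v \<Rightarrow> 'c"
  upper :: "'v \<Rightarrow> 'c"

definition polynomial_problem ::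
    "nat \<Rightarrow> nat \<Rightarrow> nat \<Rightarrow> (nat \<Rightarrow> (nat, real) mpoly) \<Rightarrow> (nat \<Rightarrow> real) \<Rightarrow> (nat \<Rightarrow> real) \<Rightarrow> (nat \<Rightarrow> real)
      \<Rightarrow> (nat, real) problem" where
  "polynomial_problem n R1 R \<phi> \<beta> l u =
    \<lparr> vars = {1..n},
      objective = \<phi> 0,
      constraints = {Ge (\<phi> r) (\<beta> r) | r. r \<in> {1..R1}} \<union> {Eq (\<phi> r) (\<beta> r) | r. r \<in> {R1+1..R}},
      lower = l,
      upper = u \<rparr>"

definition polys :: "('v, 'c::comm_ring_1) problem \<Rightarrow> ('v, 'c) mpoly set" where
  "polys P = insert (objective P) (body ` constraints P)"

definition monomials :: "('v, 'c::comm_ring_1) problem \<Rightarrow> 'v multiset set" where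
  "monomials P = (\<Union>p\<in>polys P. Poly_Mapping.keys p)"

definition problem_degree :: "('v, 'c::comm_ring_1) problem \<Rightarrow> nat" where
  "problem_degree P = Max (total_degree ` polys P)"

definition J_sets :: "('v, 'c::comm_ring_1) problem \<Rightarrow> 'v multiset set" where
  "J_sets P = {J \<in> monomials P. size J > 1 \<and> \<not> (\<exists>K\<in>monomials P. J \<subset># K)}"

datatype 'v lp_var = Orig 'v | RLT "'v multiset"

definition linearize_monomial :: "'v multiset \<Rightarrow> 'v lp_var multiset" where
  "linearize_monomial I = (if size I > 1 then {#RLT I#} else image_mset Orig I)"

definition linearize :: "('v, 'c::comm_ring_1) mpoly \<Rightarrow> ('v lp_var, 'c) mpoly" where
  "linearize = map_monomials linearize_monomial"

definition bound_factor ::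
    "('v, 'c::comm_ring_1) problem \<Rightarrow> 'v multiset \<Rightarrow> 'v multiset \<Rightarrow> ('v, 'c) mpoly" where
  "bound_factor P J1 J2 =
    (\<Prod>i\<in>#J1. var i - const (lower P i)) * (\<Prod>i\<in>#J2. const (upper P i) - var i)"

text \<open>The linear program keeps the original box, which is not among \<open>lp_constraints\<close>; RLT
  variables carry no bounds of their own.\<close>

record (overloaded) ('v, 'c) linear_program =
  lp_vars :: "'v lp_var set"
  lp_objective :: "('v lp_var, 'c) mpoly"
  lp_constraints :: "('v lp_var, 'c) constr set"
  lp_lower :: "'v \<Rightarrow> 'c"
  lp_upper :: "'v \<Rightarrow> 'c"

definition rlt_relaxation :: "('v, 'c::comm_ring_1) problem \<Rightarrow> ('v, 'c) linear_program" where
  "rlt_relaxation P =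
    \<lparr> lp_vars = Orig ` vars P \<union> {RLT I | I J. J \<in> J_sets P \<and> I \<subseteq># J \<and> size I \<ge> 2},
      lp_objective = linearize (objective P),
      lp_constraints =
        map_constr_of linearize id ` constraints P \<union>
        {Ge (linearize (bound_factor P J1 J2)) 0 | J J1 J2. J \<in> J_sets P \<and> J1 + J2 = J},
      lp_lower = lower P,
      lp_upper = upper P \<rparr>"

text \<open>The variable \<open>X\<^sup>Q\<^sub>J\<close> is the multiset \<open>J\<close> itself; the singleton \<open>{#j#}\<close> is
  \<open>x\<^sub>j\<close>, which builds in the convention that \<open>X\<^sup>Q\<close> of a singleton is the original variable.\<close>

type_synonym qvar = "nat multiset"

definition quadrify_monomial :: "nat multiset \<Rightarrow> qvar multiset" where
  "quadrify_monomial J = (if size J > 2 then {#J#} else image_mset (\<lambda>j. {#j#}) J)"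

definition quadrify :: "(nat, 'c::comm_ring_1) mpoly \<Rightarrow> (qvar, 'c) mpoly" where
  "quadrify = map_monomials quadrify_monomial"

text \<open>\<open>product_constr J\<^sub>1 J\<^sub>2\<close> is the constraint that \<open>X\<^sup>Q\<close> of the sum of \<open>J\<^sub>1\<close> and \<open>J\<^sub>2\<close> equals
  the product of \<open>X\<^sup>Q\<close> of \<open>J\<^sub>1\<close> and \<open>X\<^sup>Q\<close> of \<open>J\<^sub>2\<close>. It is symmetric in its arguments, so an
  unordered pair gives a single constraint.\<close>

definition product_constr :: "nat multiset \<Rightarrow> nat multiset \<Rightarrow> (qvar, 'c::comm_ring_1) constr" where
  "product_constr J1 J2 = Eq (var (J1 + J2) - var J1 * var J2) 0"

definition quadratic_problem ::
    "(nat, 'c::comm_ring_1) problem \<Rightarrow> (qvar, 'c) constr set \<Rightarrow> (qvar, 'c) problem" where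
  "quadratic_problem P C =
    (let obj = quadrify (objective P);
         cons = map_constr_of quadrify id ` constraints P \<union> C
     in \<lparr> vars = (\<lambda>j. {#j#}) ` vars P
                 \<union> (\<Union>p \<in> insert obj (body ` cons). \<Union>m \<in> Poly_Mapping.keys p. set_mset m),
          objective = obj,
          constraints = cons,
          lower = (\<lambda>J. \<Prod>j\<in>#J. lower P j),
          upper = (\<lambda>J. \<Prod>j\<in>#J. upper P j) \<rparr>)"

text \<open>With \<open>js\<close> the nondecreasing listing of \<open>J\<close>, the \<open>k\<close>-th constraint equates \<open>X\<^sup>Q\<close> of the
  first \<open>k\<close> entries with \<open>X\<^sup>Q\<close> of the first \<open>k - 1\<close> entries times \<open>x\<close> of the \<open>k\<close>-th entry
  (\<open>js ! (k - 1)\<close>, as lists are indexed from 0); for \<open>k = 2\<close> both factors are original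
  variables.\<close>

definition scheme1 :: "(nat, 'c::comm_ring_1) problem \<Rightarrow> (qvar, 'c) problem" where
  "scheme1 P = quadratic_problem P
    {product_constr (mset (take (k - 1) js)) {#js ! (k - 1)#} | J js k.
       J \<in> monomials P \<and> size J > 2 \<and> js = sorted_list_of_multiset J \<and> 2 \<le> k \<and> k \<le> size J}"

definition scheme2 :: "(nat, 'c::comm_ring_1) problem \<Rightarrow> (qvar, 'c) problem" where
  "scheme2 P = quadratic_problem P
    {product_constr J1 J2 | J J' J1 J2.
       J \<in> J_sets P \<and> size J > 2 \<and> J' \<subseteq># J \<and> size J' \<ge> 2 \<and>
       J1 \<noteq> {#} \<and> J2 \<noteq> {#} \<and> J1 + J2 = J'}"

definition scheme3 :: "(nat, 'c::comm_ring_1) problem \<Rightarrow> (qvar, 'c) problem" where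
  "scheme3 P = quadratic_problem P
    {product_constr J1 J2 | J' J1 J2.
       set_mset J' \<subseteq> vars P \<and> 2 \<le> size J' \<and> size J' \<le> problem_degree P \<and>
       J1 \<noteq> {#} \<and> J2 \<noteq> {#} \<and> J1 + J2 = J'}"

text \<open>For counting, bounds are treated symbolically: the numerical bounds are replaced by
  independent indeterminates adjoined to the coefficient ring, so that accidental values such as
  \<open>l\<^sub>j = 0\<close> or \<open>l\<^sub>j = u\<^sub>j\<close> neither cancel terms nor identify bound-factor constraints. Bounds of
  \<open>X\<^sup>Q\<close> variables become products of these indeterminates.\<close>

datatype 'v bound_symbol = LowerSym 'v | UpperSym 'v

type_synonym 'v sym_coeff = "('v bound_symbol, real) mpoly"

definition symbolic_poly :: "('v, real) mpoly \<Rightarrow> ('v, 'v sym_coeff) mpoly" where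
  "symbolic_poly = Poly_Mapping.map const"

definition symbolic :: "('v, real) problem \<Rightarrow> ('v, 'v sym_coeff) problem" where
  "symbolic P =
    \<lparr> vars = vars P,
      objective = symbolic_poly (objective P),
      constraints = map_constr_of symbolic_poly const ` constraints P,
      lower = (\<lambda>j. var (LowerSym j)),
      upper = (\<lambda>j. var (UpperSym j)) \<rparr>"

definition num_vars :: "('v, 'c) linear_program \<Rightarrow> nat" where
  "num_vars L = card (lp_vars L)"

definition num_constraints :: "('v, 'c) linear_program \<Rightarrow> nat" where
  "num_constraints L = card (lp_constraints L)"

end

theory Submission
  imports Defs
begin

text \<open>
  Every count in the theorem is monotone because the three relaxations are literally nested: as
  sets, the variables and the constraints of the relaxation for Scheme 1 are contained in those
  for Scheme 2, which are contained in those for Scheme 3. Besides the inclusions, the largest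
  relaxation has to be finite, since the cardinality of an infinite set is zero by convention.

  Nesting starts with the product constraints that the schemes add. A monomial of degree greater
  than two lies below some \<open>J\<close>-set, and each Scheme 1 constraint splits off the last factor of a
  prefix of the monomial, hence is one of the splittings that Scheme 2 makes of all submultisets
  of that \<open>J\<close>-set (\<open>scheme1_products_subset_scheme2\<close>). Submultisets of a \<open>J\<close>-set use variables of
  the problem only and have size at most its degree, so Scheme 3 splits them too
  (\<open>scheme2_products_subset_scheme3\<close>).

  Nested constraints give nested variables and nested monomials, but \<open>J\<close>-sets are the \<^emph>\<open>maximal\<close>
  monomials and could in general disappear when a problem grows. They do not here, because a
  quadrified problem has no monomial of size above two, so that each monomial of size two is a
  \<open>J\<close>-set (\<open>J_sets_if_quadratic\<close>). As all three quadratic problems attach the same bounds to the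
  same variable, a \<open>J\<close>-set contributes the same bound-factor constraints and the same RLT
  variables to each relaxation that has it (\<open>rlt_relaxation_mono\<close>).
\<close>

section \<open>Monomials and J-sets\<close>

lemma finite_bounded_multisets:
  assumes "finite A"
  shows "finite {J. set_mset J \<subseteq> A \<and> size J \<le> n}"
proof -
  have "{J. set_mset J \<subseteq> A \<and> size J \<le> n} = (\<Union>k\<le>n. multisets_of_size A k)"
    by (auto simp: multisets_of_size_def)
  then show ?thesis using assms by auto
qed

lemma finite_submultisets: "finite {I. I \<subseteq># J}"
  by (rule finite_subset[OF _ finite_bounded_multisets[of "set_mset J" "size J"]])
    (auto dest: set_mset_mono size_mset_mono)

lemma body_map_constr: "body (map_constr_of f g c) = f (body c)"
  by (cases c) simp_all

lemma keys_map_monomials_subset: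
  "Poly_Mapping.keys (map_monomials f p) \<subseteq> f ` Poly_Mapping.keys p"
  unfolding map_monomials_def
  by (rule order_trans[OF keys_sum]) (auto split: if_splits)

lemma keys_map_subset: "f 0 = 0 \<Longrightarrow> Poly_Mapping.keys (Poly_Mapping.map f p) \<subseteq> Poly_Mapping.keys p"
  by (auto simp: in_keys_iff map.rep_eq when_def)

lemma finite_monomials:
  assumes "finite (constraints P)"
  shows "finite (monomials P)"
  using assms by (simp add: monomials_def polys_def)

lemma size_le_problem_degree:
  assumes "finite (constraints P)" and "m \<in> monomials P"
  shows "size m \<le> problem_degree P"
proof -
  from assms(2) obtain p where p: "p \<in> polys P" "m \<in> Poly_Mapping.keys p"
    by (auto simp: monomials_def)
  have "size m \<le> total_degree p"
    unfolding total_degree_def using p(2) by (intro Max_ge) auto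
  also have "\<dots> \<le> problem_degree P"
    unfolding problem_degree_def using p(1) assms(1) by (intro Max_ge) (auto simp: polys_def)
  finally show ?thesis .
qed

text \<open>Climbing from a monomial to ever larger ones ends at a \<open>J\<close>-set because there are only
  finitely many monomials.\<close>

lemma monomial_subset_J_set:
  assumes "finite (constraints P)" and "J \<in> monomials P" and "size J > 1"
  obtains K where "K \<in> J_sets P" and "J \<subseteq># K"
proof -
  obtain K where K: "K \<in> monomials P" "J \<subseteq># K"
      "\<And>K'. K' \<in> monomials P \<Longrightarrow> K \<subseteq># K' \<Longrightarrow> K' = K"
    using subset_mset.finite_has_maximal2[OF finite_monomials[OF assms(1)] assms(2)] by metis
  have "size K > 1" using size_mset_mono[OF K(2)] assms(3) by simp
  with K have "K \<in> J_sets P" by (auto simp: J_sets_def subset_mset.less_le)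
  with K(2) that show thesis by blast
qed

text \<open>The maximality condition in the definition of \<open>J\<close>-sets is vacuous once no monomial is larger
  than the smallest size that counts. This makes \<open>J\<close>-sets monotone in the set of monomials, which
  can fail for problems of higher degree.\<close>

lemma J_sets_if_quadratic:
  assumes "\<And>m. m \<in> monomials P \<Longrightarrow> size m \<le> 2"
  shows "J_sets P = {J \<in> monomials P. size J = 2}"
  using assms by (fastforce simp: J_sets_def dest: mset_subset_size)

section \<open>Monotonicity and finiteness of the relaxation\<close>

text \<open>Equality of the bounds is required for all variables because they enter the bound-factor
  constraints themselves: with other bounds, the same \<open>J\<close>-set would yield other constraints.\<close>

lemma rlt_relaxation_mono:
  assumes "vars P \<subseteq> vars Q" "constraints P \<subseteq> constraints Q" "J_sets P \<subseteq> J_sets Q"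
    and "lower P = lower Q" "upper P = upper Q"
  shows "lp_vars (rlt_relaxation P) \<subseteq> lp_vars (rlt_relaxation Q)"
    and "lp_constraints (rlt_relaxation P) \<subseteq> lp_constraints (rlt_relaxation Q)"
proof -
  have bf: "bound_factor P = bound_factor Q"
    by (intro ext) (simp add: bound_factor_def assms(4,5))
  show "lp_vars (rlt_relaxation P) \<subseteq> lp_vars (rlt_relaxation Q)"
    using assms(1,3) by (auto simp: rlt_relaxation_def)
  show "lp_constraints (rlt_relaxation P) \<subseteq> lp_constraints (rlt_relaxation Q)"
    using assms(2,3) by (auto simp: rlt_relaxation_def bf)
qed


lemma finite_rlt_relaxation:
  assumes "finite (vars P)" "finite (constraints P)"
  shows "finite (lp_vars (rlt_relaxation P))"
    and "finite (lp_constraints (rlt_relaxation P))"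
proof -
  have fin_J: "finite (J_sets P)"
    using finite_monomials[OF assms(2)] by (simp add: J_sets_def)
  have "finite (\<Union>J\<in>J_sets P. RLT ` {I. I \<subseteq># J})"
    using fin_J by (simp add: finite_submultisets)
  then have "finite {RLT I | I J. J \<in> J_sets P \<and> I \<subseteq># J \<and> size I \<ge> 2}"
    by (rule rev_finite_subset) auto
  then show "finite (lp_vars (rlt_relaxation P))"
    using assms(1) by (simp add: rlt_relaxation_def)
  have "finite (\<Union>J\<in>J_sets P. \<Union>J1\<in>{I. I \<subseteq># J}. \<Union>J2\<in>{I. I \<subseteq># J}.
                  {Ge (linearize (bound_factor P J1 J2)) 0})"
    using fin_J by (simp add: finite_submultisets)
  then have "finite {Ge (linearize (bound_factor P J1 J2)) 0 | J J1 J2. J \<in> J_sets P \<and> J1 + J2 = J}"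
    by (rule rev_finite_subset)
      (clarify, blast intro: mset_subset_eq_add_left mset_subset_eq_add_right)
  then show "finite (lp_constraints (rlt_relaxation P))"
    unfolding rlt_relaxation_def linear_program.simps using assms(2) by blast
qed

section \<open>Quadrified problems\<close>

lemma monomials_quadrify_size:
  "m \<in> Poly_Mapping.keys (quadrify p) \<Longrightarrow> size m \<le> 2"
  using keys_map_monomials_subset[of quadrify_monomial p]
  by (auto simp: quadrify_def quadrify_monomial_def split: if_splits)

lemma monomials_product_constr_size:
  assumes "m \<in> Poly_Mapping.keys (body (product_constr J1 J2))"
  shows "size m \<le> 2"
proof -
  have "Poly_Mapping.keys (body (product_constr J1 J2) :: (qvar, 'a) mpoly)
        \<subseteq> {{#J1 + J2#}, {#J1, J2#}}"
    by (auto simp: product_constr_def var_def mult_single in_keys_iff lookup_minus lookup_single when_def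
        split: if_splits)
  with assms show ?thesis by auto
qed

lemma finite_quadratic_problem:
  assumes "finite (vars P)" "finite (constraints P)" "finite C"
  shows "finite (vars (quadratic_problem P C))"
    and "finite (constraints (quadratic_problem P C))"
  using assms by (auto simp: quadratic_problem_def Let_def)

text \<open>No monomial of a quadrified problem has size above two: original monomials of larger
  degree collapse to a single variable, and a product constraint multiplies two variables.\<close>

lemma J_sets_quadratic_problem:
  fixes P :: "(nat, 'c::comm_ring_1) problem"
  assumes "C \<subseteq> range (case_prod product_constr)"
  shows "J_sets (quadratic_problem P C) =
    {J \<in> monomials (quadratic_problem P C). size J = 2}"
proof (rule J_sets_if_quadratic)
  fix m assume "m \<in> monomials (quadratic_problem P C)"
  moreover have "monomials (quadratic_problem P C)
      \<subseteq> (\<Union>p :: (nat, 'c) mpoly. Poly_Mapping.keys (quadrify p)) \<union> (\<Union>c\<in>C. Poly_Mapping.keys (body c))"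
    by (auto simp: monomials_def polys_def quadratic_problem_def Let_def body_map_constr)
  ultimately consider p :: "(nat, 'c) mpoly" where "m \<in> Poly_Mapping.keys (quadrify p)"
    | c where "c \<in> C" "m \<in> Poly_Mapping.keys (body c)"
    by blast
  then show "size m \<le> 2"
  proof cases
    case 1
    then show ?thesis by (rule monomials_quadrify_size)
  next
    case 2
    with assms show ?thesis by (auto dest: monomials_product_constr_size)
  qed
qed

lemma quadratic_relaxation_mono:
  assumes "C \<subseteq> D" and "D \<subseteq> range (case_prod product_constr)"
  shows "lp_vars (rlt_relaxation (quadratic_problem P C))
           \<subseteq> lp_vars (rlt_relaxation (quadratic_problem P D))"
    and "lp_constraints (rlt_relaxation (quadratic_problem P C))
           \<subseteq> lp_constraints (rlt_relaxation (quadratic_problem P D))"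
proof -
  let ?P = "quadratic_problem P C" and ?Q = "quadratic_problem P D"
  have "vars ?P \<subseteq> vars ?Q" "constraints ?P \<subseteq> constraints ?Q"
    "lower ?P = lower ?Q" "upper ?P = upper ?Q"
    using assms(1) by (auto simp: quadratic_problem_def Let_def)
  moreover have "monomials ?P \<subseteq> monomials ?Q"
    using assms(1) by (auto simp: monomials_def polys_def quadratic_problem_def Let_def)
  then have "J_sets ?P \<subseteq> J_sets ?Q"
    using assms by (auto simp: J_sets_quadratic_problem)
  ultimately show "lp_vars (rlt_relaxation ?P) \<subseteq> lp_vars (rlt_relaxation ?Q)"
    and "lp_constraints (rlt_relaxation ?P) \<subseteq> lp_constraints (rlt_relaxation ?Q)"
    by (simp_all add: rlt_relaxation_mono)
qed

section \<open>Nesting of the schemes\<close>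

text \<open>The constraints added by each scheme, separated from the quadrified problem around them so
  that they can be compared as sets.\<close>

definition scheme1_products :: "(nat, 'c::comm_ring_1) problem \<Rightarrow> (qvar, 'c) constr set" where
  "scheme1_products P =
    {product_constr (mset (take (k - 1) js)) {#js ! (k - 1)#} | J js k.
       J \<in> monomials P \<and> size J > 2 \<and> js = sorted_list_of_multiset J \<and> 2 \<le> k \<and> k \<le> size J}"

definition scheme2_products :: "(nat, 'c::comm_ring_1) problem \<Rightarrow> (qvar, 'c) constr set" where
  "scheme2_products P =
    {product_constr J1 J2 | J J' J1 J2.
       J \<in> J_sets P \<and> size J > 2 \<and> J' \<subseteq># J \<and> size J' \<ge> 2 \<and>
       J1 \<noteq> {#} \<and> J2 \<noteq> {#} \<and> J1 + J2 = J'}"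

definition scheme3_products :: "(nat, 'c::comm_ring_1) problem \<Rightarrow> (qvar, 'c) constr set" where
  "scheme3_products P =
    {product_constr J1 J2 | J' J1 J2.
       set_mset J' \<subseteq> vars P \<and> 2 \<le> size J' \<and> size J' \<le> problem_degree P \<and>
       J1 \<noteq> {#} \<and> J2 \<noteq> {#} \<and> J1 + J2 = J'}"

lemma scheme_conv_products:
  "scheme1 P = quadratic_problem P (scheme1_products P)"
  "scheme2 P = quadratic_problem P (scheme2_products P)"
  "scheme3 P = quadratic_problem P (scheme3_products P)"
  unfolding scheme1_def scheme2_def scheme3_def
    scheme1_products_def scheme2_products_def scheme3_products_def
  by (rule refl)+

lemma scheme_products_in_range:
  "scheme2_products P \<subseteq> range (case_prod product_constr)"
  "scheme3_products P \<subseteq> range (case_prod product_constr)"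
  by (auto simp: scheme2_products_def scheme3_products_def)

lemma finite_scheme3_products:
  assumes "finite (vars P)"
  shows "finite (scheme3_products P)"
proof -
  let ?M = "{J. set_mset J \<subseteq> vars P \<and> size J \<le> problem_degree P}"
  have "finite (case_prod product_constr ` (?M \<times> ?M))"
    using finite_bounded_multisets[OF assms] by simp
  moreover have "scheme3_products P \<subseteq> case_prod product_constr ` (?M \<times> ?M)"
    unfolding scheme3_products_def by force
  ultimately show ?thesis by (rule rev_finite_subset)
qed

text \<open>The constraint that extends a prefix of the sorted monomial by its next entry is the
  splitting of the longer prefix, a submultiset of any \<open>J\<close>-set above the monomial, into the
  shorter prefix and a singleton.\<close>

lemma scheme1_products_subset_scheme2:
  assumes "finite (constraints P)"
  shows "scheme1_products P \<subseteq> scheme2_products P"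
proof
  fix c assume "c \<in> scheme1_products P"
  then obtain J js k where c: "c = product_constr (mset (take (k - 1) js)) {#js ! (k - 1)#}"
    and J: "J \<in> monomials P" "size J > 2" and js: "js = sorted_list_of_multiset J"
    and k: "2 \<le> k" "k \<le> size J"
    unfolding scheme1_products_def by blast
  obtain K where K: "K \<in> J_sets P" "J \<subseteq># K"
    using monomial_subset_J_set[OF assms J(1)] J(2) by auto
  have mset_js: "mset js = J" by (simp add: js)
  then have len: "length js = size J" by (metis size_mset)
  have prefix: "mset (take (k - 1) js) + {#js ! (k - 1)#} = mset (take k js)"
    using take_Suc_conv_app_nth[of "k - 1" js] k len by simp
  have "mset (take k js) \<subseteq># J"
    by (metis mset_js append_take_drop_id mset_append mset_subset_eq_add_left)
  then have "mset (take k js) \<subseteq># K" using K(2) by (rule subset_mset.order_trans)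
  moreover have "size (mset (take k js)) \<ge> 2" using k len by simp
  moreover have "size K > 2" using size_mset_mono[OF K(2)] J(2) by simp
  moreover have "mset (take (k - 1) js) \<noteq> {#}" using k len by auto
  moreover have "{#js ! (k - 1)#} \<noteq> {#}" by simp
  ultimately show "c \<in> scheme2_products P"
    unfolding scheme2_products_def c using K(1) prefix by blast
qed

lemma scheme2_products_subset_scheme3:
  assumes "finite (constraints P)" and "\<And>m. m \<in> monomials P \<Longrightarrow> set_mset m \<subseteq> vars P"
  shows "scheme2_products P \<subseteq> scheme3_products P"
proof
  fix c assume "c \<in> scheme2_products P"
  then obtain J J' J1 J2 where c: "c = product_constr J1 J2" "J1 \<noteq> {#}" "J2 \<noteq> {#}" "J1 + J2 = J'"
    and J: "J \<in> monomials P" and J': "J' \<subseteq># J" "size J' \<ge> 2"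
    by (auto simp: scheme2_products_def J_sets_def)
  have "set_mset J' \<subseteq> vars P"
    using set_mset_mono[OF J'(1)] assms(2)[OF J] by blast
  moreover have "size J' \<le> problem_degree P"
    using size_mset_mono[OF J'(1)] size_le_problem_degree[OF assms(1) J] by linarith
  ultimately show "c \<in> scheme3_products P"
    unfolding scheme3_products_def using c J'(2) by blast
qed

section \<open>Comparison of the sizes\<close>

text \<open>The coefficient ring is arbitrary here, so that the lemma applies to problems with symbolic
  bounds. Whether or not the bounds make two bound-factor constraints coincide, they do so in all
  three relaxations alike, which leaves the inclusions intact.\<close>

lemma scheme_relaxation_sizes:
  fixes P :: "(nat, 'c::comm_ring_1) problem"
  assumes "finite (vars P)" "finite (constraints P)"
    and "\<And>m. m \<in> monomials P \<Longrightarrow> set_mset m \<subseteq> vars P"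
  defines "L1 \<equiv> rlt_relaxation (scheme1 P)"
    and "L2 \<equiv> rlt_relaxation (scheme2 P)"
    and "L3 \<equiv> rlt_relaxation (scheme3 P)"
  shows "num_vars L1 \<le> num_vars L2 \<and> num_vars L2 \<le> num_vars L3 \<and>
         num_constraints L1 \<le> num_constraints L2 \<and>
         num_constraints L2 \<le> num_constraints L3"
proof -
  note L_defs = L1_def L2_def L3_def scheme_conv_products
  have sub12: "lp_vars L1 \<subseteq> lp_vars L2" "lp_constraints L1 \<subseteq> lp_constraints L2"
    unfolding L_defs
    by (intro quadratic_relaxation_mono scheme1_products_subset_scheme2
        scheme_products_in_range assms(2))+
  have sub23: "lp_vars L2 \<subseteq> lp_vars L3" "lp_constraints L2 \<subseteq> lp_constraints L3"
    unfolding L_defs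
    by (intro quadratic_relaxation_mono scheme2_products_subset_scheme3
        scheme_products_in_range assms(2,3); assumption)+
  have fin3: "finite (lp_vars L3)" "finite (lp_constraints L3)"
    unfolding L_defs
    by (intro finite_rlt_relaxation finite_quadratic_problem finite_scheme3_products assms(1,2))+
  show ?thesis
    unfolding num_vars_def num_constraints_def
    using sub12 sub23 fin3 by (meson card_mono finite_subset)
qed

theorem theorem1:
  fixes n R1 R :: nat
    and \<phi> :: "nat \<Rightarrow> (nat, real) mpoly"
    and \<beta> l u :: "nat \<Rightarrow> real"
  assumes "R1 \<le> R"
    and "\<And>r m. r \<le> R \<Longrightarrow> m \<in> Poly_Mapping.keys (\<phi> r) \<Longrightarrow> set_mset m \<subseteq> {1..n}"
    and "\<And>j. j \<in> {1..n} \<Longrightarrow> 0 \<le> l j \<and> l j \<le> u j"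
  defines "PP \<equiv> polynomial_problem n R1 R \<phi> \<beta> l u"
  defines "LP1 \<equiv> rlt_relaxation (scheme1 (symbolic PP))"
    and "LP2 \<equiv> rlt_relaxation (scheme2 (symbolic PP))"
    and "LP3 \<equiv> rlt_relaxation (scheme3 (symbolic PP))"
  shows "num_vars LP1 \<le> num_vars LP2 \<and> num_vars LP2 \<le> num_vars LP3 \<and>
         num_constraints LP1 \<le> num_constraints LP2 \<and>
         num_constraints LP2 \<le> num_constraints LP3"
proof -
  have "finite (vars (symbolic PP))" "finite (constraints (symbolic PP))"
    by (simp_all add: PP_def symbolic_def polynomial_problem_def setcompr_eq_image)
  moreover have "set_mset m \<subseteq> vars (symbolic PP)" if m: "m \<in> monomials (symbolic PP)" for m
  proof -
    have "polys (symbolic PP) \<subseteq> symbolic_poly ` \<phi> ` {..R}"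
      using assms(1)
      by (auto simp: polys_def PP_def symbolic_def polynomial_problem_def body_map_constr)
    with m obtain r where r: "r \<le> R" "m \<in> Poly_Mapping.keys (symbolic_poly (\<phi> r))"
      unfolding monomials_def by blast
    then have "m \<in> Poly_Mapping.keys (\<phi> r)"
      using keys_map_subset[of const "\<phi> r"] by (auto simp: symbolic_poly_def const_def)
    with r(1) assms(2) show ?thesis by (simp add: PP_def symbolic_def polynomial_problem_def)
  qed
  ultimately show ?thesis
    unfolding LP1_def LP2_def LP3_def by (rule scheme_relaxation_sizes)
qed

end
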